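(* Let $F$ be a field, let $K$ be a Galois $C_n$-algebra over $F$ of dimension $n$ with ${\rm Aut}_F(K)=\langle\sigma\rangle$, $\sigma$ of order $n$, and let $d\in K\setminus F$ (with $d\in K^\times$). (i) The opposite algebra $(K/F,\sigma,d)^{op}$ is isomorphic to the algebra obtained by using left instead of right division by the polynomial $t^n-\sigma^{-n}(d)\in K[t;\sigma^{-1}]$. (ii) Let $K/F$ be a cyclic Galois field extension of degree $n$ with Galois group $G=\langle\sigma\rangle$, and let $H=\{\tau\in G\mid\tau(d)=d\}$. Suppose that $H=\langle\sigma^s\rangle$ for some integer $s$ with $1<s<n$. Then $(K/F,\sigma,d)^{op}$ is not isomorphic to a nonassociative cyclic algebra over $F$.
   Context: Algebras are unital and not necessarily associative. A Galois $C_n$-algebra over $F$ is an $n$-dimensional étale $F$-algebra $K$ with an action of a cyclic group $C_n$ of $F$-automorphisms whose fixed ring is $F$. For an automorphism $\rho$ of $K$, $K[t;\rho]$ is the skew polynomial ring with $ta=\rho(a)t$. For monic $f\in K[t;\rho]$ of degree $m$, the right-division algebra $K[t;\rho]/K[t;\rho]f$ has underlying additive group $\{g\mid\deg g<m\}$ and multiplication $g\circ h=$ the unique $r$ with $\deg r<m$ and $gh=qf+r$. The algebra obtained by left division, $K[t;\rho]/fK[t;\rho]$ (denoted ${}_fS$), has the same additive group and multiplication $g\diamond h=$ the unique $r$ with $\deg r<m$ and $gh=fq+r$. The nonassociative cyclic algebra $(K/F,\sigma,d)$ ($K$ a Galois $C_n$-algebra over $F$ of dimension $n$ with ${\rm Aut}_F(K)=\langle\sigma\rangle$,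 $d\in K^\times$) is the $F$-central algebra $K[t;\sigma]/K[t;\sigma](t^n-d)$. *)

theory Defs
  imports "HOL-Computational_Algebra.Polynomial" "HOL-Computational_Algebra.Factorial_Ring"
begin

text \<open>
  A commutative algebra over the field \<open>'f\<close> is a commutative ring type \<open>'k\<close> together with a
  scalar multiplication \<open>sc\<close>. The base field is identified with its image \<open>F\<cdot>1\<close>.
\<close>

definition comm_algebra :: "('f::field \<Rightarrow> 'k::comm_ring_1 \<Rightarrow> 'k) \<Rightarrow> bool" where
  "comm_algebra sc \<longleftrightarrow> vector_space sc \<and> (\<forall>a x y. sc a (x * y) = sc a x * y)"

definition base_field :: "('f::field \<Rightarrow> 'k::comm_ring_1 \<Rightarrow> 'k) \<Rightarrow> 'k set" where
  "base_field sc = range (\<lambda>a. sc a 1)"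

text \<open>
  For an idempotent \<open>e\<close>, the ideal \<open>eK\<close> is a ring with unit element \<open>e\<close>. The next two predicates
  say that \<open>eK\<close> is a field, and that \<open>x \<in> eK\<close> has a separable minimal polynomial over the base
  field (the constant term of the polynomial being multiplied by the unit \<open>e\<close> of \<open>eK\<close>).
\<close>

definition field_component :: "'k::comm_ring_1 \<Rightarrow> bool" where
  "field_component e \<longleftrightarrow> e \<noteq> 0 \<and> e * e = e \<and> (\<forall>x. e * x \<noteq> 0 \<longrightarrow> (\<exists>y. (e * x) * (e * y) = e))"

definition separable_in_component ::
  "('f::field \<Rightarrow> 'k::comm_ring_1 \<Rightarrow> 'k) \<Rightarrow> 'k \<Rightarrow> 'k \<Rightarrow> bool" where
  "separable_in_component sc e x \<longleftrightarrow>
     (\<exists>p :: 'f poly. irreducible p \<and> coprime p (pderiv p) \<and>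
        (\<Sum>i\<le>degree p. sc (coeff p i) (e * x ^ i)) = 0)"

text \<open>
  Etale: a finite product of finite separable field extensions, the factors being the ideals
  \<open>eK\<close> for a complete set \<open>E\<close> of orthogonal idempotents.
\<close>

definition etale_algebra :: "('f::field \<Rightarrow> 'k::comm_ring_1 \<Rightarrow> 'k) \<Rightarrow> bool" where
  "etale_algebra sc \<longleftrightarrow>
     comm_algebra sc \<and>
     (\<exists>B. finite B \<and> module.span sc B = UNIV) \<and>
     (\<exists>E. finite E \<and> (\<Sum>e\<in>E. e) = 1 \<and>
        (\<forall>e\<in>E. \<forall>e'\<in>E. e \<noteq> e' \<longrightarrow> e * e' = 0) \<and>
        (\<forall>e\<in>E. field_component e \<and> (\<forall>x. separable_in_component sc e (e * x))))"

definition algebra_auts :: "('f::field \<Rightarrow> 'k::comm_ring_1 \<Rightarrow> 'k) \<Rightarrow> ('k \<Rightarrow> 'k) set" where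
  "algebra_auts sc = {\<tau>. bij \<tau> \<and> Vector_Spaces.linear sc sc \<tau> \<and>
     \<tau> 1 = 1 \<and> (\<forall>x y. \<tau> (x * y) = \<tau> x * \<tau> y)}"

definition cyclic_group_gen :: "('a \<Rightarrow> 'a) \<Rightarrow> ('a \<Rightarrow> 'a) set" where
  "cyclic_group_gen \<sigma> = {\<tau>. \<exists>k::nat. \<tau> = \<sigma> ^^ k \<or> \<tau> = (inv \<sigma>) ^^ k}"

definition has_order :: "('a \<Rightarrow> 'a) \<Rightarrow> nat \<Rightarrow> bool" where
  "has_order \<sigma> n \<longleftrightarrow> 0 < n \<and> \<sigma> ^^ n = id \<and> (\<forall>k. 0 < k \<and> k < n \<longrightarrow> \<sigma> ^^ k \<noteq> id)"

text \<open>Here \<open>\<sigma>\<close> is the generator through which the cyclic group of order \<open>n\<close> acts.\<close>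

definition galois_cyclic_algebra ::
  "('f::field \<Rightarrow> 'k::comm_ring_1 \<Rightarrow> 'k) \<Rightarrow> nat \<Rightarrow> ('k \<Rightarrow> 'k) \<Rightarrow> bool" where
  "galois_cyclic_algebra sc n \<sigma> \<longleftrightarrow>
     etale_algebra sc \<and> vector_space.dim sc UNIV = n \<and>
     \<sigma> \<in> algebra_auts sc \<and> has_order \<sigma> n \<and>
     {x. \<forall>\<tau>\<in>cyclic_group_gen \<sigma>. \<tau> x = x} = base_field sc"

record ('f, 'a) nonassoc_algebra =
  alg_carrier :: "'a set"
  alg_add :: "'a \<Rightarrow> 'a \<Rightarrow> 'a"
  alg_scale :: "'f \<Rightarrow> 'a \<Rightarrow> 'a"
  alg_mult :: "'a \<Rightarrow> 'a \<Rightarrow> 'a"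
  alg_one :: "'a"

definition opposite_algebra :: "('f, 'a) nonassoc_algebra \<Rightarrow> ('f, 'a) nonassoc_algebra" where
  "opposite_algebra A = A\<lparr>alg_mult := \<lambda>x y. alg_mult A y x\<rparr>"

definition algebra_isomorphic ::
  "('f, 'a) nonassoc_algebra \<Rightarrow> ('f, 'b) nonassoc_algebra \<Rightarrow> bool" where
  "algebra_isomorphic A B \<longleftrightarrow>
     (\<exists>\<phi>. bij_betw \<phi> (alg_carrier A) (alg_carrier B) \<and>
        \<phi> (alg_one A) = alg_one B \<and>
        (\<forall>a. \<forall>x\<in>alg_carrier A. \<phi> (alg_scale A a x) = alg_scale B a (\<phi> x)) \<and>
        (\<forall>x\<in>alg_carrier A. \<forall>y\<in>alg_carrier A.
           \<phi> (alg_add A x y) = alg_add B (\<phi> x) (\<phi> y) \<and>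
           \<phi> (alg_mult A x y) = alg_mult B (\<phi> x) (\<phi> y)))"

text \<open>
  The additive group of \<open>K[t;\<rho>]\<close> is that of \<open>'k poly\<close>, coefficients being written to the left of
  the powers of \<open>t\<close>. The rule \<open>t a = \<rho>(a) t\<close> gives \<open>(a t\<^sup>i) (b t\<^sup>j) = a \<rho>\<^sup>i(b) t\<^sup>i\<^sup>+\<^sup>j\<close>.
  Note that \<open>*\<close> on \<open>'k poly\<close> is not the multiplication of \<open>K[t;\<rho>]\<close>.
\<close>

definition skew_mult :: "('k::comm_ring_1 \<Rightarrow> 'k) \<Rightarrow> 'k poly \<Rightarrow> 'k poly \<Rightarrow> 'k poly" where
  "skew_mult \<rho> g h =
     (\<Sum>i\<le>degree g. \<Sum>j\<le>degree h. monom (coeff g i * (\<rho> ^^ i) (coeff h j)) (i + j))"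

text \<open>In \<^const>\<open>degree\<close> the zero polynomial has degree 0, hence the extra disjunct.\<close>

definition degree_below :: "'k::zero poly \<Rightarrow> nat \<Rightarrow> bool" where
  "degree_below g m \<longleftrightarrow> g = 0 \<or> degree g < m"

definition right_rem ::
  "('k::comm_ring_1 \<Rightarrow> 'k) \<Rightarrow> 'k poly \<Rightarrow> 'k poly \<Rightarrow> 'k poly" where
  "right_rem \<rho> f g = (THE r. degree_below r (degree f) \<and> (\<exists>q. g = skew_mult \<rho> q f + r))"

definition left_rem ::
  "('k::comm_ring_1 \<Rightarrow> 'k) \<Rightarrow> 'k poly \<Rightarrow> 'k poly \<Rightarrow> 'k poly" where
  "left_rem \<rho> f g = (THE r. degree_below r (degree f) \<and> (\<exists>q. g = skew_mult \<rho> f q + r))"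

definition right_division_algebra ::
  "('f::field \<Rightarrow> 'k::comm_ring_1 \<Rightarrow> 'k) \<Rightarrow> ('k \<Rightarrow> 'k) \<Rightarrow> 'k poly \<Rightarrow> ('f, 'k poly) nonassoc_algebra"
  where
  "right_division_algebra sc \<rho> f =
     \<lparr>alg_carrier = {g. degree_below g (degree f)},
      alg_add = (+),
      alg_scale = (\<lambda>a g. smult (sc a 1) g),
      alg_mult = (\<lambda>g h. right_rem \<rho> f (skew_mult \<rho> g h)),
      alg_one = 1\<rparr>"

definition left_division_algebra ::
  "('f::field \<Rightarrow> 'k::comm_ring_1 \<Rightarrow> 'k) \<Rightarrow> ('k \<Rightarrow> 'k) \<Rightarrow> 'k poly \<Rightarrow> ('f, 'k poly) nonassoc_algebra"
  where
  "left_division_algebra sc \<rho> f =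
     \<lparr>alg_carrier = {g. degree_below g (degree f)},
      alg_add = (+),
      alg_scale = (\<lambda>a g. smult (sc a 1) g),
      alg_mult = (\<lambda>g h. left_rem \<rho> f (skew_mult \<rho> g h)),
      alg_one = 1\<rparr>"

definition cyclic_algebra_data ::
  "('f::field \<Rightarrow> 'k::comm_ring_1 \<Rightarrow> 'k) \<Rightarrow> nat \<Rightarrow> ('k \<Rightarrow> 'k) \<Rightarrow> 'k \<Rightarrow> bool" where
  "cyclic_algebra_data sc n \<sigma> d \<longleftrightarrow>
     galois_cyclic_algebra sc n \<sigma> \<and> algebra_auts sc = cyclic_group_gen \<sigma> \<and> d dvd 1"

definition nonassoc_cyclic_algebra ::
  "('f::field \<Rightarrow> 'k::comm_ring_1 \<Rightarrow> 'k) \<Rightarrow> nat \<Rightarrow> ('k \<Rightarrow> 'k) \<Rightarrow> 'k \<Rightarrow> ('f, 'k poly) nonassoc_algebra"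
  where
  "nonassoc_cyclic_algebra sc n \<sigma> d = right_division_algebra sc \<sigma> (monom 1 n - [:d:])"

end

theory Submission
  imports Defs "HOL-Computational_Algebra.Formal_Power_Series"
begin

text \<open>
  Write \<open>f = t\<^sup>n - d\<close> and \<open>A = K[t;\<sigma>]/K[t;\<sigma>]f\<close>. Since \<open>\<sigma>\<^sup>n = id\<close>, the polynomial
  \<open>t\<^sup>n - \<sigma>\<^sup>-\<^sup>n(d)\<close> is \<open>f\<close> itself, read in \<open>K[t;\<sigma>\<^sup>-\<^sup>1]\<close>.

  For the isomorphism, \<open>a t\<^sup>i \<mapsto> \<sigma>\<^sup>-\<^sup>i(a) t\<^sup>i\<close> is an anti-isomorphism from \<open>K[t;\<sigma>]\<close> to
  \<open>K[t;\<sigma>\<^sup>-\<^sup>1]\<close>. It preserves degrees and fixes \<open>f\<close>, hence turns division on the right by \<open>f\<close> into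
  division on the left (\<open>twist_skew_mult\<close>, \<open>twist_rmult\<close>).

  For the non-isomorphism, the left nucleus of \<open>A\<^sup>o\<^sup>p\<close> is the right nucleus of \<open>A\<close>. If
  \<open>f z = z f\<close> in \<open>K[t;\<sigma>]\<close>, then \<open>z\<close> lies in this right nucleus (\<open>rmult_assoc_right\<close>); this applies
  to every constant and, since \<open>\<sigma>\<^sup>s(d) = d\<close>, to \<open>t\<^sup>s\<close>. As \<open>\<sigma>\<^sup>s \<noteq> id\<close>, the left nucleus of
  \<open>A\<^sup>o\<^sup>p\<close> is not commutative.

  Consider now a nonassociative cyclic algebra \<open>B = (L/F,\<sigma>',d')\<close>. If \<open>\<sigma>'(d') = d'\<close>, then \<open>B\<close> is
  associative, which \<open>A\<close> is not because \<open>\<sigma>(d) \<noteq> d\<close>. Otherwise the left nucleus of \<open>B\<close> is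
  contained in the commutative ring \<open>L\<close> (\<open>left_nucleus_commutative\<close>): for \<open>z = \<Sum> z\<^sub>i t\<^sup>i\<close> in it and \<open>i > 0\<close>, the products
  \<open>(z t\<^sup>m\<^sup>-\<^sup>i) t\<^sup>k = z (t\<^sup>m\<^sup>-\<^sup>i t\<^sup>k)\<close> show that \<open>z\<^sub>i\<close> annihilates every \<open>\<sigma>'\<^sup>k(d') - d'\<close>. Since \<open>L\<close> need
  not be a field, this does not yet give \<open>z\<^sub>i = 0\<close>. But the \<open>z\<^sub>i\<close> with this property form a
  \<open>\<sigma>'\<close>-invariant ideal of \<open>L\<close>, and a Galois algebra has only the trivial ones
  (\<open>invariant_ideal_trivial\<close>): an ideal of a finite product of fields is generated by an idempotent,
  which is \<open>\<sigma>'\<close>-invariant if the ideal is, hence an idempotent of the field \<open>F\<close>.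
\<close>

section \<open>Multiplication and remainders in a skew polynomial ring\<close>

lemma binomial_eq: "monom 1 n - [:d:] = monom 1 n + monom (- d::'k::comm_ring_1) 0"
  by (simp only: diff_conv_add_uminus monom_0 minus_pCons minus_zero)

locale ring_endomorphism =
  fixes \<rho> :: "'k::comm_ring_1 \<Rightarrow> 'k"
  assumes add: "\<rho> (x + y) = \<rho> x + \<rho> y"
    and mult: "\<rho> (x * y) = \<rho> x * \<rho> y"
    and one: "\<rho> 1 = 1"
begin

lemma zero: "\<rho> 0 = 0"
  using add[of 0 0] by simp

lemma funpow_add': "(\<rho> ^^ i) (x + y) = (\<rho> ^^ i) x + (\<rho> ^^ i) y"
  by (induction i) (simp_all add: add)

lemma funpow_mult': "(\<rho> ^^ i) (x * y) = (\<rho> ^^ i) x * (\<rho> ^^ i) y"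
  by (induction i) (simp_all add: mult)

lemma funpow_one: "(\<rho> ^^ i) 1 = 1"
  by (induction i) (simp_all add: one)

lemma funpow_zero: "(\<rho> ^^ i) 0 = 0"
  by (induction i) (simp_all add: zero)

lemma funpow_uminus: "(\<rho> ^^ i) (- x) = - (\<rho> ^^ i) x"
  using funpow_add'[of i "- x" x] by (simp add: funpow_zero eq_neg_iff_add_eq_0)

lemma funpow_sum: "(\<rho> ^^ i) (sum g A) = (\<Sum>a\<in>A. (\<rho> ^^ i) (g a))"
  by (induction A rule: infinite_finite_induct) (simp_all add: funpow_zero funpow_add')

lemma coeff_skew_mult:
  "coeff (skew_mult \<rho> g h) k = (\<Sum>i\<le>k. coeff g i * (\<rho> ^^ i) (coeff h (k - i)))"
proof -
  have inner: "(\<Sum>j\<le>degree h. coeff (monom (coeff g i * (\<rho> ^^ i) (coeff h j)) (i + j)) k) =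
      (if i \<le> k then coeff g i * (\<rho> ^^ i) (coeff h (k - i)) else 0)" for i
  proof (cases "i \<le> k")
    case True
    have "(\<Sum>j\<le>degree h. coeff (monom (coeff g i * (\<rho> ^^ i) (coeff h j)) (i + j)) k) =
        (\<Sum>j\<le>degree h. if j = k - i then coeff g i * (\<rho> ^^ i) (coeff h j) else 0)"
      using True by (intro sum.cong) auto
    also have "\<dots> = coeff g i * (\<rho> ^^ i) (coeff h (k - i))"
      by (auto simp: coeff_eq_0 funpow_zero)
    finally show ?thesis using True by simp
  next
    case False
    then show ?thesis by (intro trans[OF sum.neutral]) auto
  qed
  have "coeff (skew_mult \<rho> g h) k =
      (\<Sum>i\<le>degree g. if i \<le> k then coeff g i * (\<rho> ^^ i) (coeff h (k - i)) else 0)"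
    unfolding skew_mult_def coeff_sum inner ..
  also have "\<dots> = (\<Sum>i\<in>{..degree g} \<inter> {..k}. coeff g i * (\<rho> ^^ i) (coeff h (k - i)))"
    by (subst sum.inter_restrict) (auto simp: atMost_def)
  also have "\<dots> = (\<Sum>i\<le>k. coeff g i * (\<rho> ^^ i) (coeff h (k - i)))"
    by (intro sum.mono_neutral_left) (auto intro!: le_degree)
  finally show ?thesis .
qed

lemma skew_mult_add_left: "skew_mult \<rho> (g + g') h = skew_mult \<rho> g h + skew_mult \<rho> g' h"
  by (rule poly_eqI) (simp add: coeff_skew_mult algebra_simps sum.distrib)

lemma skew_mult_add_right: "skew_mult \<rho> g (h + h') = skew_mult \<rho> g h + skew_mult \<rho> g h'"
  by (rule poly_eqI) (simp add: coeff_skew_mult funpow_add' algebra_simps sum.distrib)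

lemma skew_mult_assoc:
  "skew_mult \<rho> (skew_mult \<rho> g h) l = skew_mult \<rho> g (skew_mult \<rho> h l)"
proof (rule poly_eqI)
  fix k
  define F where "F a b c = coeff g a * (\<rho> ^^ a) (coeff h b) * (\<rho> ^^ (a + b)) (coeff l c)" for a b c
  \<comment> \<open>Both sides are the sum of \<open>F a b c\<close> over all \<open>a + b + c = k\<close>.\<close>
  have "coeff (skew_mult \<rho> (skew_mult \<rho> g h) l) k = (\<Sum>i=0..k. \<Sum>j=0..i. F j (i - j) (k - i))"
    by (simp add: coeff_skew_mult F_def sum_distrib_right atMost_atLeast0)
  also have "\<dots> = (\<Sum>j=0..k. \<Sum>i=0..k - j. F j i (k - j - i))"
    by (rule fps_mult_assoc_lemma)
  also have "\<dots> = coeff (skew_mult \<rho> g (skew_mult \<rho> h l)) k"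
    by (simp add: coeff_skew_mult F_def sum_distrib_left atMost_atLeast0 funpow_sum
        funpow_mult' funpow_add mult.assoc)
  finally show "coeff (skew_mult \<rho> (skew_mult \<rho> g h) l) k =
      coeff (skew_mult \<rho> g (skew_mult \<rho> h l)) k" .
qed

lemma coeff_skew_mult_monom_right:
  "coeff (skew_mult \<rho> g (monom c l)) k =
     (if l \<le> k then coeff g (k - l) * (\<rho> ^^ (k - l)) c else 0)"
proof -
  have "coeff (skew_mult \<rho> g (monom c l)) k =
      (\<Sum>i\<le>k. if i = k - l then (if l \<le> k then coeff g i * (\<rho> ^^ i) c else 0) else 0)"
    unfolding coeff_skew_mult by (intro sum.cong) (auto simp: funpow_zero)
  then show ?thesis by simp
qed

lemma coeff_skew_mult_monom_left:
  "coeff (skew_mult \<rho> (monom c l) g) k = (if l \<le> k then c * (\<rho> ^^ l) (coeff g (k - l)) else 0)"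
proof -
  have "coeff (skew_mult \<rho> (monom c l) g) k =
      (\<Sum>i\<le>k. if i = l then c * (\<rho> ^^ i) (coeff g (k - i)) else 0)"
    unfolding coeff_skew_mult by (intro sum.cong) auto
  then show ?thesis by simp
qed

lemma coeff_mult_binomial:
  "coeff (skew_mult \<rho> q (monom 1 n - [:d:])) k =
     (if n \<le> k then coeff q (k - n) else 0) - coeff q k * (\<rho> ^^ k) d"
  unfolding binomial_eq
  by (simp add: skew_mult_add_right coeff_skew_mult_monom_right funpow_one funpow_uminus)

lemma coeff_binomial_mult:
  "coeff (skew_mult \<rho> (monom 1 n - [:d:]) q) k =
     (if n \<le> k then (\<rho> ^^ n) (coeff q (k - n)) else 0) - d * coeff q k"
  unfolding binomial_eq
  by (simp add: skew_mult_add_left coeff_skew_mult_monom_left)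

end

lemma degree_binomial:
  assumes "n > 0" shows "degree (monom 1 n - [:d::'k::comm_ring_1:]) = n"
proof -
  have "degree (monom (- d) 0) < degree (monom (1::'k) n)"
    using assms by (simp add: degree_monom_eq monom_0)
  then show ?thesis
    unfolding binomial_eq by (subst degree_add_eq_left) (simp_all add: degree_monom_eq)
qed

lemma degree_below_iff:
  assumes "n > 0" shows "degree_below g n \<longleftrightarrow> (\<forall>k\<ge>n. coeff g k = 0)"
  unfolding degree_below_def
  using assms coeff_eq_0[of g] degree_le[of "n - 1" g]
  by (metis coeff_0 leading_coeff_0_iff linorder_not_less order_less_le_trans)

text \<open>
  The order of \<open>\<rho>\<close> divides \<open>n\<close>. Consequently \<open>t\<^sup>n\<close> commutes with all coefficients, and \<open>\<rho>\<^sup>n\<close> does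
  not appear in the coefficients of \<open>(t\<^sup>n - d) q\<close>.
\<close>

locale skew_binomial = ring_endomorphism \<rho> for \<rho> :: "'k::comm_ring_1 \<Rightarrow> 'k" +
  fixes n :: nat and d :: 'k
  assumes n_pos: "n > 0" and funpow_n: "\<rho> ^^ n = id"
begin

text \<open>The polynomial by which remainders are taken in this locale.\<close>

definition f where "f = monom 1 n - [:d:]"

lemma degree_f: "degree f = n"
  unfolding f_def using n_pos by (rule degree_binomial)

lemma funpow_n_add: "(\<rho> ^^ (k + n)) x = (\<rho> ^^ k) x"
  by (simp add: funpow_add funpow_n)

lemma coeff_mult_f:
  "coeff (skew_mult \<rho> q f) k =
     (if n \<le> k then coeff q (k - n) else 0) - coeff q k * (\<rho> ^^ k) d"
  unfolding f_def by (rule coeff_mult_binomial)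

lemma coeff_f_mult:
  "coeff (skew_mult \<rho> f q) k = (if n \<le> k then coeff q (k - n) else 0) - d * coeff q k"
  unfolding f_def by (simp add: coeff_binomial_mult funpow_n)

text \<open>
  The hypothesis holds when \<open>p f\<close> (or \<open>f p\<close>) has degree below \<open>n\<close>; it makes the leading coefficient of
  \<open>p\<close> a multiple of a coefficient above the degree. This gives the uniqueness of remainders.
\<close>

lemma poly_eq_0_if_coeff_shift:
  fixes c :: "nat \<Rightarrow> 'k"
  assumes "\<And>k. n \<le> k \<Longrightarrow> coeff p (k - n) = coeff p k * c k"
  shows "p = 0"
proof -
  have "lead_coeff p = coeff p (degree p + n) * c (degree p + n)"
    using assms[of "degree p + n"] by simp
  also have "\<dots> = 0" using n_pos by (simp add: coeff_eq_0)
  finally show ?thesis by simp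
qed

lemma right_remainder_unique:
  assumes r: "degree_below r n" "degree_below r' n"
    and eq: "skew_mult \<rho> q f + r = skew_mult \<rho> q' f + r'"
  shows "r = r'"
proof -
  have "coeff (q - q') (k - n) = coeff (q - q') k * (\<rho> ^^ k) d" if "n \<le> k" for k
    using arg_cong[OF eq, of "\<lambda>p. coeff p k"] r n_pos that
    by (simp add: coeff_mult_f degree_below_iff algebra_simps)
  then have "q - q' = 0" by (rule poly_eq_0_if_coeff_shift)
  then show ?thesis using eq by simp
qed

lemma left_remainder_unique:
  assumes r: "degree_below r n" "degree_below r' n"
    and eq: "skew_mult \<rho> f q + r = skew_mult \<rho> f q' + r'"
  shows "r = r'"
proof -
  have "coeff (q - q') (k - n) = coeff (q - q') k * d" if "n \<le> k" for k
    using arg_cong[OF eq, of "\<lambda>p. coeff p k"] r n_pos that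
    by (simp add: coeff_f_mult degree_below_iff algebra_simps)
  then have "q - q' = 0" by (rule poly_eq_0_if_coeff_shift)
  then show ?thesis using eq by simp
qed

lemma right_rem_eqI:
  assumes "degree_below r n" "g = skew_mult \<rho> q f + r"
  shows "right_rem \<rho> f g = r"
  unfolding right_rem_def degree_f
  using assms right_remainder_unique by (intro the_equality) blast+

lemma left_rem_eqI:
  assumes "degree_below r n" "g = skew_mult \<rho> f q + r"
  shows "left_rem \<rho> f g = r"
  unfolding left_rem_def degree_f
  using assms left_remainder_unique by (intro the_equality) blast+

text \<open>
  A product of two polynomials of degree below \<open>n\<close> has degree below \<open>2n\<close>; for such a polynomial the
  quotient consists of the coefficients from \<open>n\<close> on.
\<close>

lemma right_rem_eq:
  assumes "\<forall>k\<ge>2 * n. coeff g k = 0"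
  defines "r \<equiv> g - skew_mult \<rho> (poly_shift n g) f"
  shows "degree_below r n" "right_rem \<rho> f g = r"
    and "k < n \<Longrightarrow> coeff r k = coeff g k + coeff g (k + n) * (\<rho> ^^ k) d"
proof -
  show *: "degree_below r n"
    using assms(1) n_pos
    by (auto simp: degree_below_iff r_def coeff_mult_f coeff_poly_shift)
  show "right_rem \<rho> f g = r"
    by (rule right_rem_eqI[OF *, of _ "poly_shift n g"]) (simp add: r_def)
  show "k < n \<Longrightarrow> coeff r k = coeff g k + coeff g (k + n) * (\<rho> ^^ k) d"
    by (simp add: r_def coeff_mult_f coeff_poly_shift add.commute)
qed

lemma left_rem_eq:
  assumes "\<forall>k\<ge>2 * n. coeff g k = 0"
  defines "r \<equiv> g - skew_mult \<rho> f (poly_shift n g)"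
  shows "degree_below r n" "left_rem \<rho> f g = r"
    and "k < n \<Longrightarrow> coeff r k = coeff g k + d * coeff g (k + n)"
proof -
  show *: "degree_below r n"
    using assms(1) n_pos
    by (auto simp: degree_below_iff r_def coeff_f_mult coeff_poly_shift)
  show "left_rem \<rho> f g = r"
    by (rule left_rem_eqI[OF *, of _ "poly_shift n g"]) (simp add: r_def)
  show "k < n \<Longrightarrow> coeff r k = coeff g k + d * coeff g (k + n)"
    by (simp add: r_def coeff_f_mult coeff_poly_shift add.commute)
qed

lemma coeff_skew_mult_high:
  assumes "degree_below g n" "degree_below h n" "2 * n \<le> k"
  shows "coeff (skew_mult \<rho> g h) k = 0"
  unfolding coeff_skew_mult
proof (rule sum.neutral, intro ballI)
  fix i assume "i \<in> {..k}"
  then have "n \<le> i \<or> n \<le> k - i" using assms(3) by auto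
  then show "coeff g i * (\<rho> ^^ i) (coeff h (k - i)) = 0"
    using assms n_pos by (auto simp: degree_below_iff funpow_zero)
qed

text \<open>The multiplication of the algebra obtained by right division by \<open>f\<close>.\<close>

definition rmult :: "'k poly \<Rightarrow> 'k poly \<Rightarrow> 'k poly" where
  "rmult g h = right_rem \<rho> f (skew_mult \<rho> g h)"

text \<open>The multiplication of the algebra obtained by left division by \<open>f\<close>.\<close>

definition lmult :: "'k poly \<Rightarrow> 'k poly \<Rightarrow> 'k poly" where
  "lmult g h = left_rem \<rho> f (skew_mult \<rho> g h)"

context
  fixes g h :: "'k poly"
  assumes gh: "degree_below g n" "degree_below h n"
begin

lemma skew_mult_high: "\<forall>k\<ge>2 * n. coeff (skew_mult \<rho> g h) k = 0"
  using coeff_skew_mult_high[OF gh] by blast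

lemmas right_rem_product = right_rem_eq[OF skew_mult_high]
lemmas left_rem_product = left_rem_eq[OF skew_mult_high]

lemma degree_below_rmult: "degree_below (rmult g h) n"
  unfolding rmult_def using right_rem_product(1,2) by simp

lemma degree_below_lmult: "degree_below (lmult g h) n"
  unfolding lmult_def using left_rem_product(1,2) by simp

lemma skew_mult_eq_rmult: "\<exists>q. skew_mult \<rho> g h = skew_mult \<rho> q f + rmult g h"
  unfolding rmult_def right_rem_product(2) by (rule exI[of _ "poly_shift n (skew_mult \<rho> g h)"]) simp

lemma coeff_rmult:
  "k < n \<Longrightarrow> coeff (rmult g h) k =
     coeff (skew_mult \<rho> g h) k + coeff (skew_mult \<rho> g h) (k + n) * (\<rho> ^^ k) d"
  unfolding rmult_def right_rem_product(2) by (rule right_rem_product(3))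

lemma coeff_lmult:
  "k < n \<Longrightarrow> coeff (lmult g h) k =
     coeff (skew_mult \<rho> g h) k + d * coeff (skew_mult \<rho> g h) (k + n)"
  unfolding lmult_def left_rem_product(2) by (rule left_rem_product(3))

end

lemma degree_below_monom: "l < n \<Longrightarrow> degree_below (monom c l) n"
  using n_pos by (auto simp: degree_below_iff)

lemma coeff_rmult_monom:
  assumes "degree_below g n" "l < n" "k < n"
  shows "coeff (rmult g (monom c l)) k =
    (if l \<le> k then coeff g (k - l) * (\<rho> ^^ (k - l)) c
     else coeff g (k + n - l) * (\<rho> ^^ (k + n - l)) c * (\<rho> ^^ k) d)"
  using assms n_pos
  by (simp add: coeff_rmult degree_below_monom coeff_skew_mult_monom_right)
     (simp add: degree_below_iff)

lemma monom_rmult_monom: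
  assumes "i < n" "l < n"
  shows "rmult (monom b i) (monom c l) =
    (if i + l < n then monom (b * (\<rho> ^^ i) c) (i + l)
     else monom (b * (\<rho> ^^ i) c * (\<rho> ^^ (i + l - n)) d) (i + l - n))"
proof (rule poly_eqI)
  fix k
  show "coeff (rmult (monom b i) (monom c l)) k = coeff (if i + l < n
      then monom (b * (\<rho> ^^ i) c) (i + l)
      else monom (b * (\<rho> ^^ i) c * (\<rho> ^^ (i + l - n)) d) (i + l - n)) k"
  proof (cases "k < n")
    case True
    then show ?thesis using assms by (auto simp: coeff_rmult_monom degree_below_monom)
  next
    case False
    then have "coeff (rmult (monom b i) (monom c l)) k = 0"
      using degree_below_rmult[OF degree_below_monom degree_below_monom, OF assms] n_pos
      by (simp add: degree_below_iff)
    then show ?thesis using False assms by auto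
  qed
qed

section \<open>Associativity in the right division algebra\<close>

lemma f_commutes:
  assumes "\<And>k. coeff z k * (\<rho> ^^ k) d = d * coeff z k"
  shows "skew_mult \<rho> f z = skew_mult \<rho> z f"
  by (rule poly_eqI) (simp add: coeff_f_mult coeff_mult_f assms)

text \<open>
  By \<open>f z = z f\<close>, multiplication by \<open>z\<close> on the right maps \<open>K[t;\<rho>]f\<close> into itself. Hence both
  products are remainders of the same associative product \<open>x y z\<close>.
\<close>

lemma rmult_assoc_right:
  assumes "degree_below x n" "degree_below y n" "degree_below z n"
    and z: "\<And>k. coeff z k * (\<rho> ^^ k) d = d * coeff z k"
  shows "rmult (rmult x y) z = rmult x (rmult y z)"
proof -
  note D = assms(1-3) degree_below_rmult
  obtain q1 where 1: "skew_mult \<rho> x y = skew_mult \<rho> q1 f + rmult x y"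
    using skew_mult_eq_rmult D by blast
  obtain q2 where 2: "skew_mult \<rho> y z = skew_mult \<rho> q2 f + rmult y z"
    using skew_mult_eq_rmult D by blast
  obtain q3 where 3: "skew_mult \<rho> (rmult x y) z = skew_mult \<rho> q3 f + rmult (rmult x y) z"
    using skew_mult_eq_rmult D by blast
  obtain q4 where 4: "skew_mult \<rho> x (rmult y z) = skew_mult \<rho> q4 f + rmult x (rmult y z)"
    using skew_mult_eq_rmult D by blast
  have "skew_mult \<rho> (skew_mult \<rho> x y) z =
      skew_mult \<rho> (skew_mult \<rho> q1 z + q3) f + rmult (rmult x y) z"
    by (simp add: 1 3 skew_mult_add_left skew_mult_assoc f_commutes[OF z])
  moreover have "skew_mult \<rho> x (skew_mult \<rho> y z) =
      skew_mult \<rho> (skew_mult \<rho> x q2 + q4) f + rmult x (rmult y z)"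
    by (simp add: 2 4 skew_mult_add_left skew_mult_add_right skew_mult_assoc)
  ultimately show ?thesis
    using right_remainder_unique degree_below_rmult D by (metis skew_mult_assoc)
qed

text \<open>
  Take \<open>x = t\<^sup>n\<^sup>-\<^sup>i\<close>, \<open>y = t\<^sup>k\<close> and compare the coefficients of \<open>t\<^sup>k\<close>. On both sides
  \<open>t\<^sup>n\<close> is replaced once in the contribution of \<open>z\<^sub>i t\<^sup>i\<close>: on the left already in \<open>z x\<close>, with the
  factor \<open>d\<close> in degree \<open>0\<close>; on the right the factor arrives in degree \<open>k\<close> as \<open>\<rho>\<^sup>k(d)\<close>.
\<close>

lemma left_nucleus_coeff:
  assumes z: "degree_below z n"
    and assoc: "\<And>x y. degree_below x n \<Longrightarrow> degree_below y n \<Longrightarrow>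
      rmult (rmult z x) y = rmult z (rmult x y)"
    and i: "0 < i" "i < n" and k: "k < n"
  shows "coeff z i * (\<rho> ^^ k) d = coeff z i * d"
proof -
  define j where "j = n - i"
  have j: "0 < j" "j < n" "i = n - j" using i by (auto simp: j_def)
  have "coeff (rmult (rmult z (monom 1 j)) (monom 1 k)) k = coeff z i * d"
    using z j k by (simp add: coeff_rmult_monom degree_below_rmult degree_below_monom funpow_one)
  moreover have "coeff (rmult z (rmult (monom 1 j) (monom 1 k))) k = coeff z i * (\<rho> ^^ k) d"
  proof (cases "j + k < n")
    case True
    then show ?thesis
      using z j k by (simp add: monom_rmult_monom coeff_rmult_monom funpow_one)
  next
    case False
    have "j + k - n \<le> k" "k - (j + k - n) = n - j" using False j by auto
    moreover have "(\<rho> ^^ (n - j)) ((\<rho> ^^ (j + k - n)) d) = (\<rho> ^^ k) d"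
      using False j by (simp flip: funpow_add comp_apply[of "\<rho> ^^ (n - j)"])
    ultimately show ?thesis
      using False z j k by (simp add: monom_rmult_monom coeff_rmult_monom funpow_one)
  qed
  ultimately show ?thesis
    using assoc[of "monom 1 j" "monom 1 k"] j k by (simp add: degree_below_monom)
qed

end

section \<open>The twist by an automorphism\<close>

text \<open>
  The additive map \<open>a t\<^sup>k \<mapsto> \<rho>\<^sup>k(a) t\<^sup>k\<close>. For \<open>\<rho> = \<sigma>\<^sup>-\<^sup>1\<close> it rewrites the coefficients of an element of
  \<open>K[t;\<sigma>]\<close> on the right of the powers of \<open>t\<close>.
\<close>

definition twist :: "('k::comm_ring_1 \<Rightarrow> 'k) \<Rightarrow> 'k poly \<Rightarrow> 'k poly" where
  "twist \<rho> g = (\<Sum>k\<le>degree g. monom ((\<rho> ^^ k) (coeff g k)) k)"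

lemma (in ring_endomorphism) coeff_twist: "coeff (twist \<rho> g) k = (\<rho> ^^ k) (coeff g k)"
  unfolding twist_def by (auto simp: coeff_sum coeff_eq_0 funpow_zero)

locale skew_binomial_aut = skew_binomial +
  assumes bij: "bij \<rho>"
begin

lemma inv_funpow_funpow: "(inv \<rho> ^^ k) ((\<rho> ^^ k) x) = x"
  using inv_f_f[OF bij_is_inj[OF bij_fn[OF bij]], of k x] unfolding inv_fn[OF bij] .

lemma funpow_inv_funpow: "(\<rho> ^^ k) ((inv \<rho> ^^ k) x) = x"
  using surj_f_inv_f[OF bij_is_surj[OF bij_fn[OF bij]], of k x] unfolding inv_fn[OF bij] .

sublocale inv: skew_binomial "inv \<rho>" n d
proof
  have s: "\<rho> (inv \<rho> x) = x" for x
    using bij by (simp add: bij_is_surj surj_f_inv_f)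
  show "inv \<rho> (x + y) = inv \<rho> x + inv \<rho> y" for x y
    by (rule inv_f_eq) (use bij in \<open>auto simp: add s bij_is_inj\<close>)
  show "inv \<rho> (x * y) = inv \<rho> x * inv \<rho> y" for x y
    by (rule inv_f_eq) (use bij in \<open>auto simp: mult s bij_is_inj\<close>)
  show "inv \<rho> 1 = 1"
    by (rule inv_f_eq) (use bij in \<open>auto simp: one bij_is_inj\<close>)
  show "inv \<rho> ^^ n = id"
    using inv_fn[OF bij, of n] by (simp add: funpow_n)
  show "0 < n" by (rule n_pos)
qed

lemma twist_skew_mult:
  "twist (inv \<rho>) (skew_mult \<rho> g h) = skew_mult (inv \<rho>) (twist (inv \<rho>) h) (twist (inv \<rho>) g)"
proof (rule poly_eqI)
  fix k
  have cancel: "(inv \<rho> ^^ k) ((\<rho> ^^ j) x) = (inv \<rho> ^^ (k - j)) x" if "j \<le> k" for j x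
    using that funpow_add[of "k - j" j "inv \<rho>"] by (simp add: inv_funpow_funpow)
  have join: "(inv \<rho> ^^ i) ((inv \<rho> ^^ (k - i)) x) = (inv \<rho> ^^ k) x" if "i \<le> k" for i x
    using that funpow_add[of i "k - i" "inv \<rho>"] by simp
  have "coeff (twist (inv \<rho>) (skew_mult \<rho> g h)) k =
      (\<Sum>j\<le>k. (inv \<rho> ^^ k) (coeff g j) * (inv \<rho> ^^ (k - j)) (coeff h (k - j)))"
    by (simp add: inv.coeff_twist coeff_skew_mult inv.funpow_sum inv.funpow_mult' cancel)
  also have "\<dots> = (\<Sum>i\<le>k. (inv \<rho> ^^ i) (coeff h i) * (inv \<rho> ^^ k) (coeff g (k - i)))"
    by (rule sum.reindex_bij_witness[of _ "\<lambda>i. k - i" "\<lambda>i. k - i"]) auto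
  also have "\<dots> = coeff (skew_mult (inv \<rho>) (twist (inv \<rho>) h) (twist (inv \<rho>) g)) k"
    by (simp add: inv.coeff_twist inv.coeff_skew_mult inv.funpow_mult' join)
  finally show "coeff (twist (inv \<rho>) (skew_mult \<rho> g h)) k =
      coeff (skew_mult (inv \<rho>) (twist (inv \<rho>) h) (twist (inv \<rho>) g)) k" .
qed

lemma degree_below_twist: "degree_below (twist (inv \<rho>) g) n \<longleftrightarrow> degree_below g n"
proof -
  have "(inv \<rho> ^^ k) x = 0 \<longleftrightarrow> x = 0" for k x
    using funpow_inv_funpow[of k x] by (auto simp: funpow_zero inv.funpow_zero)
  then show ?thesis using n_pos by (simp add: degree_below_iff inv.coeff_twist)
qed

lemma twist_rmult:
  assumes "degree_below g n" "degree_below h n"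
  shows "twist (inv \<rho>) (rmult g h) = inv.lmult (twist (inv \<rho>) h) (twist (inv \<rho>) g)"
proof (rule poly_eqI)
  fix k
  note D = assms[THEN degree_below_twist[THEN iffD2]]
  show "coeff (twist (inv \<rho>) (rmult g h)) k =
      coeff (inv.lmult (twist (inv \<rho>) h) (twist (inv \<rho>) g)) k"
  proof (cases "k < n")
    case True
    have "coeff (twist (inv \<rho>) (rmult g h)) k =
        (inv \<rho> ^^ k) (coeff (skew_mult \<rho> g h) k) + (inv \<rho> ^^ k) (coeff (skew_mult \<rho> g h) (k + n)) * d"
      unfolding inv.coeff_twist coeff_rmult[OF assms True] inv.funpow_add' inv.funpow_mult'
        inv_funpow_funpow ..
    also have "\<dots> = coeff (twist (inv \<rho>) (skew_mult \<rho> g h)) k +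
        d * coeff (twist (inv \<rho>) (skew_mult \<rho> g h)) (k + n)"
      unfolding inv.coeff_twist inv.funpow_n_add by (simp only: mult.commute)
    also have "\<dots> = coeff (inv.lmult (twist (inv \<rho>) h) (twist (inv \<rho>) g)) k"
      unfolding twist_skew_mult inv.coeff_lmult[OF D(2,1) True] ..
    finally show ?thesis .
  next
    case False
    have "degree_below (twist (inv \<rho>) (rmult g h)) n"
      using degree_below_rmult[OF assms] by (simp add: degree_below_twist)
    moreover have "degree_below (inv.lmult (twist (inv \<rho>) h) (twist (inv \<rho>) g)) n"
      by (rule inv.degree_below_lmult[OF D(2,1)])
    ultimately show ?thesis using False n_pos by (simp add: degree_below_iff)
  qed
qed

lemma bij_betw_twist:
  "bij_betw (twist (inv \<rho>)) {g. degree_below g n} {g. degree_below g n}"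
proof (rule bij_betwI[where g = "twist \<rho>"])
  show inv1: "twist \<rho> (twist (inv \<rho>) g) = g" for g
    by (rule poly_eqI) (simp add: coeff_twist inv.coeff_twist funpow_inv_funpow)
  show inv2: "twist (inv \<rho>) (twist \<rho> g) = g" for g
    by (rule poly_eqI) (simp add: coeff_twist inv.coeff_twist inv_funpow_funpow)
  show "twist (inv \<rho>) \<in> {g. degree_below g n} \<rightarrow> {g. degree_below g n}"
    using degree_below_twist by blast
  have "degree_below (twist \<rho> g) n" if "degree_below g n" for g
    using that degree_below_twist[of "twist \<rho> g"] unfolding inv2 by blast
  then show "twist \<rho> \<in> {g. degree_below g n} \<rightarrow> {g. degree_below g n}"
    by blast
qed

lemma opposite_isomorphic_left_division:
  assumes fixed: "\<And>a. \<rho> (sc a 1) = sc a 1"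
  shows "algebra_isomorphic (opposite_algebra (right_division_algebra sc \<rho> f))
    (left_division_algebra sc (inv \<rho>) f)"
proof -
  let ?A = "opposite_algebra (right_division_algebra sc \<rho> f)"
  let ?B = "left_division_algebra sc (inv \<rho>) f"
  have A: "alg_carrier ?A = {g. degree_below g n}" "alg_add ?A = (+)" "alg_one ?A = 1"
      "alg_scale ?A = (\<lambda>a g. smult (sc a 1) g)" "alg_mult ?A x y = rmult y x" for x y
    by (simp_all only: opposite_algebra_def right_division_algebra_def degree_f rmult_def
        nonassoc_algebra.simps)
  have B: "alg_carrier ?B = {g. degree_below g n}" "alg_add ?B = (+)" "alg_one ?B = 1"
      "alg_scale ?B = (\<lambda>a g. smult (sc a 1) g)" "alg_mult ?B x y = inv.lmult x y" for x y
    by (simp_all only: left_division_algebra_def degree_f inv.lmult_def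
        nonassoc_algebra.simps)
  have fixed': "(inv \<rho> ^^ k) (sc a 1) = sc a 1" for k a
  proof -
    have "(\<rho> ^^ k) (sc a 1) = sc a 1" by (induction k) (simp_all add: fixed)
    then show ?thesis using inv_funpow_funpow[of k "sc a 1"] by simp
  qed
  have "twist (inv \<rho>) 1 = 1"
    by (rule poly_eqI) (simp add: inv.coeff_twist inv.funpow_zero inv.funpow_one)
  moreover have "twist (inv \<rho>) (smult (sc a 1) x) = smult (sc a 1) (twist (inv \<rho>) x)" for a x
    by (rule poly_eqI) (simp add: inv.coeff_twist inv.funpow_mult' fixed')
  moreover have "twist (inv \<rho>) (x + y) = twist (inv \<rho>) x + twist (inv \<rho>) y" for x y
    by (rule poly_eqI) (simp add: inv.coeff_twist inv.funpow_add')
  ultimately show ?thesis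
    unfolding algebra_isomorphic_def A B mem_Collect_eq
    using bij_betw_twist twist_rmult by (intro exI[of _ "twist (inv \<rho>)"] conjI) blast+
qed

end

section \<open>Nuclei under isomorphism\<close>

text \<open>The elements that associate with all others when placed first, respectively last.\<close>

definition left_nucleus :: "('f, 'a) nonassoc_algebra \<Rightarrow> 'a set" where
  "left_nucleus A = {z \<in> alg_carrier A. \<forall>x\<in>alg_carrier A. \<forall>y\<in>alg_carrier A.
     alg_mult A (alg_mult A z x) y = alg_mult A z (alg_mult A x y)}"

definition right_nucleus :: "('f, 'a) nonassoc_algebra \<Rightarrow> 'a set" where
  "right_nucleus A = {z \<in> alg_carrier A. \<forall>x\<in>alg_carrier A. \<forall>y\<in>alg_carrier A.
     alg_mult A (alg_mult A x y) z = alg_mult A x (alg_mult A y z)}"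

lemma left_nucleus_opposite: "left_nucleus (opposite_algebra A) = right_nucleus A"
  by (auto simp: left_nucleus_def right_nucleus_def opposite_algebra_def)

lemma isomorphic_left_nucleus:
  assumes "algebra_isomorphic A B"
    and closed: "\<And>x y. x \<in> alg_carrier A \<Longrightarrow> y \<in> alg_carrier A \<Longrightarrow> alg_mult A x y \<in> alg_carrier A"
  obtains \<phi> where "bij_betw \<phi> (alg_carrier A) (alg_carrier B)"
    "\<And>x y. x \<in> alg_carrier A \<Longrightarrow> y \<in> alg_carrier A \<Longrightarrow>
       \<phi> (alg_mult A x y) = alg_mult B (\<phi> x) (\<phi> y)"
    "\<And>x. x \<in> alg_carrier A \<Longrightarrow> \<phi> x \<in> left_nucleus B \<longleftrightarrow> x \<in> left_nucleus A"
proof -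
  obtain \<phi> where bij: "bij_betw \<phi> (alg_carrier A) (alg_carrier B)"
    and hom: "\<And>x y. x \<in> alg_carrier A \<Longrightarrow> y \<in> alg_carrier A \<Longrightarrow>
       \<phi> (alg_mult A x y) = alg_mult B (\<phi> x) (\<phi> y)"
    using assms(1) unfolding algebra_isomorphic_def by blast
  have im: "alg_carrier B = \<phi> ` alg_carrier A" and inj: "inj_on \<phi> (alg_carrier A)"
    using bij by (auto simp: bij_betw_def)
  have "\<phi> z \<in> left_nucleus B \<longleftrightarrow> z \<in> left_nucleus A" if "z \<in> alg_carrier A" for z
    using that
    by (simp add: left_nucleus_def im inj_on_eq_iff[OF inj] closed flip: hom)
  then show thesis using that bij hom by blast
qed

section \<open>Galois algebras\<close>

lemma algebra_auts_ring_endomorphism: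
  "\<sigma> \<in> algebra_auts sc \<Longrightarrow> ring_endomorphism \<sigma>"
  unfolding algebra_auts_def ring_endomorphism_def
  by (auto simp: Vector_Spaces.linear_iff)

lemma base_field_iff:
  assumes "galois_cyclic_algebra sc n \<sigma>"
  shows "x \<in> base_field sc \<longleftrightarrow> \<sigma> x = x"
proof -
  have bf: "base_field sc = {x. \<forall>\<tau>\<in>cyclic_group_gen \<sigma>. \<tau> x = x}" and bij: "bij \<sigma>"
    using assms by (auto simp: galois_cyclic_algebra_def algebra_auts_def)
  have "\<sigma> \<in> cyclic_group_gen \<sigma>"
    unfolding cyclic_group_gen_def by (auto intro: exI[of _ "1::nat"])
  moreover have "(\<sigma> ^^ k) x = x" "(inv \<sigma> ^^ k) x = x" if "\<sigma> x = x" for k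
  proof -
    have "inv \<sigma> x = x" using that bij by (metis bij_inv_eq_iff)
    then show "(\<sigma> ^^ k) x = x" "(inv \<sigma> ^^ k) x = x"
      using that by (induction k) simp_all
  qed
  ultimately show ?thesis by (auto simp: bf cyclic_group_gen_def)
qed

text \<open>
  The identity element \<open>g\<close> of the ideal \<open>J\<close> is the sum of those primitive idempotents that lie in \<open>J\<close>.
\<close>

lemma invariant_ideal_trivial:
  fixes sc :: "'f::field \<Rightarrow> 'k::comm_ring_1 \<Rightarrow> 'k"
  assumes gal: "galois_cyclic_algebra sc n \<sigma>"
    and sum: "\<And>x y. x \<in> J \<Longrightarrow> y \<in> J \<Longrightarrow> x + y \<in> J"
    and ideal: "\<And>x y. x \<in> J \<Longrightarrow> x * y \<in> J"
    and inv: "\<And>x. x \<in> J \<Longrightarrow> \<sigma> x \<in> J"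
    and a: "a \<in> J" "a \<noteq> 0"
  shows "1 \<in> J"
proof -
  interpret ring_endomorphism \<sigma>
    using gal by (auto simp: galois_cyclic_algebra_def intro: algebra_auts_ring_endomorphism)
  obtain E :: "'k set" where E: "finite E" "(\<Sum>e\<in>E. e) = 1" "\<And>e. e \<in> E \<Longrightarrow> field_component e"
    using gal by (auto simp: galois_cyclic_algebra_def etale_algebra_def)
  have n: "0 < n" "\<sigma> ^^ n = id" and vs: "vector_space sc"
    and sc_mult: "\<And>c x y. sc c (x * y) = sc c x * y"
    using gal by (auto simp: galois_cyclic_algebra_def has_order_def etale_algebra_def
        comm_algebra_def)
  interpret vector_space sc by (rule vs)
  define g where "g = (\<Sum>e\<in>E \<inter> J. e)"
  have "0 \<in> J" using ideal[OF a(1), of 0] by simp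
  then have "sum (\<lambda>e. e) A \<in> J" if "A \<subseteq> J" for A
    using that by (induction A rule: infinite_finite_induct) (auto intro: sum)
  then have gJ: "g \<in> J" by (auto simp: g_def)
  have absorb: "g * b = b" if b: "b \<in> J" for b
  proof -
    have "e * b = 0" if e: "e \<in> E - E \<inter> J" for e
    proof (rule ccontr)
      assume "e * b \<noteq> 0"
      then obtain y where "(e * b) * (e * y) = e"
        using E(3) e unfolding field_component_def by blast
      then have "b * (e * (e * y)) = e" by (simp add: ac_simps)
      then show False using ideal[OF b, of "e * (e * y)"] e by simp
    qed
    then have "(\<Sum>e\<in>E \<inter> J. e * b) = (\<Sum>e\<in>E. e * b)"
      by (intro sum.mono_neutral_left) (use E in auto)
    then show ?thesis by (simp add: g_def E(2) flip: sum_distrib_right)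
  qed
  \<comment> \<open>\<open>g\<close> divides \<open>\<sigma> g\<close>; apply \<open>\<sigma>\<close> to the same statement for \<open>\<sigma>\<^sup>-\<^sup>1 g = \<sigma>\<^sup>n\<^sup>-\<^sup>1 g\<close> to obtain the converse.\<close>
  have "(\<sigma> ^^ k) g \<in> J" for k
    by (induction k) (auto simp: gJ inv)
  then have "g * (\<sigma> ^^ (n - 1)) g = (\<sigma> ^^ (n - 1)) g" by (rule absorb)
  then have "\<sigma> g * \<sigma> ((\<sigma> ^^ (n - 1)) g) = \<sigma> ((\<sigma> ^^ (n - 1)) g)" by (metis mult)
  moreover have "\<sigma> ((\<sigma> ^^ (n - 1)) g) = g"
    using n by (metis One_nat_def Suc_pred comp_apply funpow.simps(2) id_apply)
  ultimately have "\<sigma> g * g = g" by simp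
  then have "\<sigma> g = g" using absorb[OF inv[OF gJ]] by (simp add: mult.commute)
  then obtain c where c: "g = sc c 1"
    using base_field_iff[OF gal, of g] by (auto simp: base_field_def)
  have "c \<noteq> 0" using absorb[OF a(1)] a(2) by (auto simp: c)
  have "sc c g = g * g" using sc_mult[of c 1 g] by (simp add: c)
  then have "sc c g = sc c 1" using absorb[OF gJ] c by simp
  then have "g = 1" using \<open>c \<noteq> 0\<close> by simp
  then show ?thesis using gJ by simp
qed

lemma galois_skew_binomial_aut:
  assumes "galois_cyclic_algebra sc n \<sigma>"
  shows "skew_binomial_aut \<sigma> n"
proof -
  have \<sigma>: "\<sigma> \<in> algebra_auts sc" "0 < n" "\<sigma> ^^ n = id"
    using assms unfolding galois_cyclic_algebra_def has_order_def by blast+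
  interpret ring_endomorphism \<sigma>
    using \<sigma>(1) by (rule algebra_auts_ring_endomorphism)
  show ?thesis
    by unfold_locales (use \<sigma> in \<open>simp_all add: algebra_auts_def\<close>)
qed

section \<open>Nonassociative cyclic algebras\<close>

context skew_binomial
begin

lemma nonassoc_cyclic_algebra_eq:
  "nonassoc_cyclic_algebra sc n \<rho> d = \<lparr>alg_carrier = {g. degree_below g n}, alg_add = (+),
     alg_scale = (\<lambda>a g. smult (sc a 1) g), alg_mult = rmult, alg_one = 1\<rparr>"
proof -
  have "rmult = (\<lambda>g h. right_rem \<rho> f (skew_mult \<rho> g h))"
    by (intro ext) (rule rmult_def)
  then show ?thesis
    unfolding nonassoc_cyclic_algebra_def right_division_algebra_def f_def[symmetric] degree_f
    by simp
qed

lemma mem_right_nucleus_iff: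
  "z \<in> right_nucleus (nonassoc_cyclic_algebra sc n \<rho> d) \<longleftrightarrow> degree_below z n \<and>
     (\<forall>x y. degree_below x n \<longrightarrow> degree_below y n \<longrightarrow> rmult (rmult x y) z = rmult x (rmult y z))"
  unfolding right_nucleus_def nonassoc_cyclic_algebra_eq nonassoc_algebra.simps by blast

lemma mem_left_nucleus_iff:
  "z \<in> left_nucleus (nonassoc_cyclic_algebra sc n \<rho> d) \<longleftrightarrow> degree_below z n \<and>
     (\<forall>x y. degree_below x n \<longrightarrow> degree_below y n \<longrightarrow> rmult (rmult z x) y = rmult z (rmult x y))"
  unfolding left_nucleus_def nonassoc_cyclic_algebra_eq nonassoc_algebra.simps by blast

lemma mem_right_nucleus:
  assumes "degree_below z n" "\<And>k. coeff z k * (\<rho> ^^ k) d = d * coeff z k"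
  shows "z \<in> right_nucleus (nonassoc_cyclic_algebra sc n \<rho> d)"
  unfolding mem_right_nucleus_iff
proof (intro conjI allI impI)
  show "degree_below z n" by (rule assms(1))
  show "rmult (rmult x y) z = rmult x (rmult y z)"
    if "degree_below x n" "degree_below y n" for x y
    using that assms by (rule rmult_assoc_right)
qed

lemma monom_mem_right_nucleus:
  assumes "l < n" "(\<rho> ^^ l) d = d"
  shows "monom c l \<in> right_nucleus (nonassoc_cyclic_algebra sc n \<rho> d)"
proof (rule mem_right_nucleus)
  show "degree_below (monom c l) n" using assms(1) by (rule degree_below_monom)
  show "coeff (monom c l) k * (\<rho> ^^ k) d = d * coeff (monom c l) k" for k
    by (cases "k = l") (simp_all add: assms(2) mult.commute)
qed

lemma associative_if_fixed:
  assumes "\<rho> d = d"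
  shows "left_nucleus (nonassoc_cyclic_algebra sc n \<rho> d) = {g. degree_below g n}"
proof -
  have fixed: "(\<rho> ^^ k) d = d" for k by (induction k) (simp_all add: assms)
  have "rmult (rmult x y) z = rmult x (rmult y z)"
    if "degree_below x n" "degree_below y n" "degree_below z n" for x y z
  proof (rule rmult_assoc_right[OF that])
    show "coeff z k * (\<rho> ^^ k) d = d * coeff z k" for k
      by (simp only: fixed mult.commute)
  qed
  then show ?thesis using mem_left_nucleus_iff by blast
qed

text \<open>The elements \<open>t\<close>, \<open>t\<^sup>n\<^sup>-\<^sup>1\<close>, \<open>t\<close> do not associate: \<open>(t t\<^sup>n\<^sup>-\<^sup>1) t = d t\<close> but \<open>t (t\<^sup>n\<^sup>-\<^sup>1 t) = \<rho>(d) t\<close>.\<close>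

lemma not_associative:
  assumes "\<rho> d \<noteq> d" "1 < n"
  shows "monom 1 1 \<notin> right_nucleus (nonassoc_cyclic_algebra sc n \<rho> d)"
proof
  assume *: "monom 1 1 \<in> right_nucleus (nonassoc_cyclic_algebra sc n \<rho> d)"
  have "degree_below (monom 1 1) n" "degree_below (monom 1 (n - 1)) n"
    using assms(2) by (auto intro!: degree_below_monom)
  then have "rmult (rmult (monom 1 1) (monom 1 (n - 1))) (monom 1 1) =
      rmult (monom 1 1) (rmult (monom 1 (n - 1)) (monom 1 1))"
    using * unfolding mem_right_nucleus_iff by blast
  moreover have "rmult (monom 1 1) (monom 1 (n - 1)) = monom d 0"
    using assms(2) by (subst monom_rmult_monom) (auto simp: one)
  moreover have "rmult (monom 1 (n - 1)) (monom 1 1) = monom d 0"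
    using assms(2) by (subst monom_rmult_monom) (auto simp: funpow_one)
  moreover have "rmult (monom d 0) (monom 1 1) = monom d 1"
    using assms(2) by (subst monom_rmult_monom) auto
  moreover have "rmult (monom 1 1) (monom d 0) = monom (\<rho> d) 1"
    using assms(2) by (subst monom_rmult_monom) auto
  ultimately have "monom d 1 = monom (\<rho> d) 1" by metis
  then show False using assms(1) by (simp add: monom_eq_iff)
qed

text \<open>The left nucleus consists of constant polynomials.\<close>

lemma left_nucleus_commutative:
  assumes gal: "galois_cyclic_algebra sc n \<rho>" and d: "\<rho> d \<noteq> d"
    and z: "z \<in> left_nucleus (nonassoc_cyclic_algebra sc n \<rho> d)"
    and w: "w \<in> left_nucleus (nonassoc_cyclic_algebra sc n \<rho> d)"
  shows "rmult z w = rmult w z"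
proof -
  have const: "z = monom (coeff z 0) 0"
    if z: "z \<in> left_nucleus (nonassoc_cyclic_algebra sc n \<rho> d)" for z
  proof (rule poly_eqI)
    fix i
    define J where "J = {a. \<forall>k. a * (\<rho> ^^ k) d = a * d}"
    have below: "degree_below z n"
      and assoc: "\<And>x y. degree_below x n \<Longrightarrow> degree_below y n \<Longrightarrow>
        rmult (rmult z x) y = rmult z (rmult x y)"
      using z unfolding mem_left_nucleus_iff by blast+
    have J_invariant: "\<rho> a \<in> J" if "a \<in> J" for a
    proof -
      have *: "\<rho> a * (\<rho> ^^ Suc k) d = \<rho> a * \<rho> d" for k
        using that by (simp add: J_def flip: mult)
      \<comment> \<open>\<open>\<rho>\<^sup>n d = d\<close> turns the right-hand side \<open>\<rho> d\<close> into \<open>d\<close>.\<close>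
      from *[of "n - 1"] have "\<rho> a * d = \<rho> a * \<rho> d"
        using n_pos funpow_n by simp
      then have "\<rho> a * (\<rho> ^^ k) d = \<rho> a * d" for k
        using * by (cases k) auto
      then show ?thesis by (simp add: J_def)
    qed
    have J_ideal: "x * y \<in> J" if "x \<in> J" for x y
    proof -
      have "y * (x * (\<rho> ^^ k) d) = y * (x * d)" for k using that by (simp add: J_def)
      then show ?thesis by (simp add: J_def ac_simps)
    qed
    have J_sum: "x + y \<in> J" if "x \<in> J" "y \<in> J" for x y
      using that by (simp add: J_def distrib_right)
    have "coeff z i = 0" if "0 < i"
    proof (rule ccontr)
      assume nz: "coeff z i \<noteq> 0"
      then have "i < n" using below n_pos by (meson degree_below_iff not_less)
      have "coeff z i * (\<rho> ^^ k) d = coeff z i * d" for k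
      proof -
        have "(\<rho> ^^ (k mod n)) d = (\<rho> ^^ k) d"
          by (rule funpow_mod_eq) (simp add: funpow_n)
        then show ?thesis
          using left_nucleus_coeff[OF below assoc \<open>0 < i\<close> \<open>i < n\<close>, of "k mod n"] n_pos by simp
      qed
      then have "coeff z i \<in> J" by (simp add: J_def)
      then have "1 \<in> J"
        using invariant_ideal_trivial[OF gal, of J "coeff z i"] J_sum J_ideal J_invariant nz
        by blast
      then have "1 * (\<rho> ^^ 1) d = 1 * d" unfolding J_def by blast
      then show False using d by simp
    qed
    then show "coeff z i = coeff (monom (coeff z 0) 0) i" by (cases "i = 0") auto
  qed
  obtain a b where "z = monom a 0" "w = monom b 0"
    using const[OF z] const[OF w] by blast
  then show ?thesis
    using n_pos by (simp add: monom_rmult_monom mult.commute)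
qed

end

theorem corollary2:
  fixes scK :: "'f::field \<Rightarrow> 'k::comm_ring_1 \<Rightarrow> 'k"
    and n :: nat and \<sigma> :: "'k \<Rightarrow> 'k" and d :: 'k
  assumes "galois_cyclic_algebra scK n \<sigma>"
    and "algebra_auts scK = cyclic_group_gen \<sigma>"
    and "d \<notin> base_field scK"
    and "d dvd 1"
  shows
    "algebra_isomorphic
       (opposite_algebra (nonassoc_cyclic_algebra scK n \<sigma> d))
       (left_division_algebra scK (inv \<sigma>) (monom 1 n - [:(inv \<sigma> ^^ n) d:]))
     \<and>
     (\<forall>s::nat.
        (\<forall>x::'k. x \<noteq> 0 \<longrightarrow> x dvd 1) \<and>
        1 < s \<and> s < n \<and>
        {\<tau> \<in> algebra_auts scK. \<tau> d = d} = cyclic_group_gen (\<sigma> ^^ s)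
        \<longrightarrow>
        (\<forall>(scL :: 'f \<Rightarrow> 'l::comm_ring_1 \<Rightarrow> 'l) m \<sigma>' d'.
           cyclic_algebra_data scL m \<sigma>' d' \<longrightarrow>
           \<not> algebra_isomorphic
               (opposite_algebra (nonassoc_cyclic_algebra scK n \<sigma> d))
               (nonassoc_cyclic_algebra scL m \<sigma>' d')))"
proof (intro conjI allI impI notI)
  interpret A: skew_binomial_aut \<sigma> n d
    using assms(1) by (rule galois_skew_binomial_aut)
  have sc_fixed: "\<sigma> (scK a 1) = scK a 1" for a
    using base_field_iff[OF assms(1), of "scK a 1"] by (auto simp: base_field_def)
  show "algebra_isomorphic
       (opposite_algebra (nonassoc_cyclic_algebra scK n \<sigma> d))
       (left_division_algebra scK (inv \<sigma>) (monom 1 n - [:(inv \<sigma> ^^ n) d:]))"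
    using A.opposite_isomorphic_left_division[of scK, OF sc_fixed]
    by (simp add: nonassoc_cyclic_algebra_def A.f_def A.inv.funpow_n)

  fix s scL m \<sigma>' d'
  let ?A = "nonassoc_cyclic_algebra scK n \<sigma> d"
  let ?B = "nonassoc_cyclic_algebra (scL :: 'f \<Rightarrow> 'l \<Rightarrow> 'l) m \<sigma>' d'"
  assume s: "(\<forall>x::'k. x \<noteq> 0 \<longrightarrow> x dvd 1) \<and> 1 < s \<and> s < n \<and>
      {\<tau> \<in> algebra_auts scK. \<tau> d = d} = cyclic_group_gen (\<sigma> ^^ s)"
    and dataL: "cyclic_algebra_data scL m \<sigma>' d'"
    and iso: "algebra_isomorphic (opposite_algebra ?A) ?B"
  have galL: "galois_cyclic_algebra scL m \<sigma>'"
    using dataL by (simp add: cyclic_algebra_data_def)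
  interpret B: skew_binomial_aut \<sigma>' m d'
    using galL by (rule galois_skew_binomial_aut)
  have d_moved: "\<sigma> d \<noteq> d"
    using assms(3) base_field_iff[OF assms(1)] by blast
  have op: "alg_carrier (opposite_algebra ?A) = {g. degree_below g n}"
      "alg_mult (opposite_algebra ?A) x y = A.rmult y x" for x y
    by (simp_all add: opposite_algebra_def A.nonassoc_cyclic_algebra_eq)
  have B: "alg_carrier ?B = {g. degree_below g m}" "alg_mult ?B = B.rmult"
    by (simp_all add: B.nonassoc_cyclic_algebra_eq)
  obtain \<phi> where bij: "bij_betw \<phi> {g. degree_below g n} {g. degree_below g m}"
    and hom: "\<And>x y. degree_below x n \<Longrightarrow> degree_below y n \<Longrightarrow>
       \<phi> (A.rmult y x) = B.rmult (\<phi> x) (\<phi> y)"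
    and nuc: "\<And>x. degree_below x n \<Longrightarrow> \<phi> x \<in> left_nucleus ?B \<longleftrightarrow> x \<in> right_nucleus ?A"
    by (rule isomorphic_left_nucleus[OF iso])
      (auto simp: op B left_nucleus_opposite A.degree_below_rmult)
  show False
  proof (cases "\<sigma>' d' = d'")
    case True
    have "degree_below (monom 1 1) n"
      using s by (intro A.degree_below_monom) auto
    moreover from this have "\<phi> (monom 1 1) \<in> left_nucleus ?B"
      using bij B.associative_if_fixed[OF True, of scL] by (auto simp: bij_betw_def)
    ultimately show False
      using A.not_associative[OF d_moved, of scK] s nuc by auto
  next
    case False
    have "\<sigma> ^^ s \<in> cyclic_group_gen (\<sigma> ^^ s)"
      unfolding cyclic_group_gen_def by (auto intro: exI[of _ "1::nat"])
    then have s_fixes: "(\<sigma> ^^ s) d = d" using s by blast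
    have "\<sigma> ^^ s \<noteq> id"
      using assms(1) s by (auto simp: galois_cyclic_algebra_def has_order_def)
    then obtain a where a: "(\<sigma> ^^ s) a \<noteq> a" by (auto simp: fun_eq_iff)
    let ?u = "monom 1 s" and ?v = "monom a 0"
    have uv: "degree_below ?u n" "degree_below ?v n"
      using s by (auto intro!: A.degree_below_monom)
    have "?u \<in> right_nucleus ?A" "?v \<in> right_nucleus ?A"
      using s s_fixes by (auto intro!: A.monom_mem_right_nucleus)
    then have "B.rmult (\<phi> ?u) (\<phi> ?v) = B.rmult (\<phi> ?v) (\<phi> ?u)"
      using uv nuc B.left_nucleus_commutative[OF galL False] by blast
    then have "\<phi> (A.rmult ?v ?u) = \<phi> (A.rmult ?u ?v)"
      using hom[OF uv] hom[OF uv(2,1)] by metis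
    then have "A.rmult ?v ?u = A.rmult ?u ?v"
      using bij A.degree_below_rmult[OF uv] A.degree_below_rmult[OF uv(2,1)]
      unfolding bij_betw_def by (auto dest: inj_onD)
    then show False
      using a s by (simp add: A.monom_rmult_monom)
  qed
qed

end
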